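(* Let the system be affected by anomalies only at the output stage, so that $Y_t=h_0(X_t)+\epsilon_t$ for all $t\in\mathbb{Z}$ (the input anomalies satisfy $\delta_t=0$), and let the anomaly-free outputs $Y^0_t=h_0(X_t)$ be in $p$-reasonable order with respect to the inputs $X_t$ for some $p>0$. Then the outputs $Y_t$ are out of $p$-reasonable order with respect to the inputs if and only if the output anomalies $\epsilon_t$ are out of $p$-reasonable order with respect to the inputs.
   Context: The inputs $(X_t)_{t\in\mathbb{Z}}$ are a stationary sequence of real-valued random variables whose marginal cdf's are all the same and continuous; the inputs are assumed (almost surely) pairwise distinct, so the order statistics of $X_1,\dots,X_n$ satisfy $X_{1:n}<\cdots<X_{n:n}$. The baseline function is $h_0:\mathbb{R}\to\mathbb{R}$, and the output anomalies $(\epsilon_t)_{t\in\mathbb{Z}}$ are real-valued random variables. For any sequence of real random variables $W_t$, its concomitants with respect to the inputs are $W_{t,n}=\sum_{s=1}^n W_s\mathbf{1}\{X_s=X_{t:n}\}$, $t=1,\dots,n$. The sequence $W_t$ is in $p$-reasonable order with respect to the inputs if $n^{-1/p}\sum_{t=2}^n|W_{t,n}-W_{t-1,n}|=O_{\mathbb{P}}(1)$ when $n\to\infty$, and out of $p$-reasonable order with respect to the inputs if $n^{-1/p}\sum_{t=2}^n|W_{t,n}-W_{t-1,n}|\to_{\mathbb{P}}\infty$, meaning that for every $\lambda<\infty$ the probability that this quantity is at most $\lambda$ tends to $0$. *)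

theory Defs
  imports "HOL-Probability.Probability"
begin

text \<open>Strict stationarity: the law of the whole process on the product space is shift invariant.\<close>

definition stationary :: "'a measure \<Rightarrow> (int \<Rightarrow> 'a \<Rightarrow> real) \<Rightarrow> bool" where
  "stationary M X \<longleftrightarrow>
     (\<forall>k. distr M (\<Pi>\<^sub>M t\<in>UNIV. borel) (\<lambda>\<omega> t. X (t + k) \<omega>) =
          distr M (\<Pi>\<^sub>M t\<in>UNIV. borel) (\<lambda>\<omega> t. X t \<omega>))"

text \<open>The \<open>t\<close>-th smallest of \<open>x 1, \<dots>, x n\<close>; meaningful for \<open>1 \<le> t \<le> n\<close> only
  (lists are indexed from 0).\<close>

definition order_stat :: "nat \<Rightarrow> (int \<Rightarrow> real) \<Rightarrow> nat \<Rightarrow> real" where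
  "order_stat n x t = sort (map x [1..int n]) ! (t - 1)"

definition concomitant ::
  "(int \<Rightarrow> 'a \<Rightarrow> real) \<Rightarrow> (int \<Rightarrow> 'a \<Rightarrow> real) \<Rightarrow> nat \<Rightarrow> nat \<Rightarrow> 'a \<Rightarrow> real" where
  "concomitant X W n t \<omega> =
     (\<Sum>s=1..int n. W s \<omega> * of_bool (X s \<omega> = order_stat n (\<lambda>r. X r \<omega>) t))"

definition order_index ::
  "real \<Rightarrow> (int \<Rightarrow> 'a \<Rightarrow> real) \<Rightarrow> (int \<Rightarrow> 'a \<Rightarrow> real) \<Rightarrow> nat \<Rightarrow> 'a \<Rightarrow> real" where
  "order_index p X W n \<omega> =
     real n powr (- 1 / p) *
     (\<Sum>t=2..n. \<bar>concomitant X W n t \<omega> - concomitant X W n (t - 1) \<omega>\<bar>)"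

text \<open>\<open>Z n = O\<^sub>P(1)\<close> as \<open>n \<rightarrow> \<infinity>\<close>.\<close>

definition bounded_in_prob :: "'a measure \<Rightarrow> (nat \<Rightarrow> 'a \<Rightarrow> real) \<Rightarrow> bool" where
  "bounded_in_prob M Z \<longleftrightarrow>
     (\<forall>e>0. \<exists>K. \<forall>\<^sub>F n in sequentially. \<P>(\<omega> in M. \<bar>Z n \<omega>\<bar> > K) \<le> e)"

definition tends_to_infinity_in_prob :: "'a measure \<Rightarrow> (nat \<Rightarrow> 'a \<Rightarrow> real) \<Rightarrow> bool" where
  "tends_to_infinity_in_prob M Z \<longleftrightarrow>
     (\<forall>K. (\<lambda>n. \<P>(\<omega> in M. Z n \<omega> \<le> K)) \<longlonglongrightarrow> 0)"

definition in_reasonable_order ::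
  "'a measure \<Rightarrow> real \<Rightarrow> (int \<Rightarrow> 'a \<Rightarrow> real) \<Rightarrow> (int \<Rightarrow> 'a \<Rightarrow> real) \<Rightarrow> bool" where
  "in_reasonable_order M p X W \<longleftrightarrow> bounded_in_prob M (order_index p X W)"

definition out_of_reasonable_order ::
  "'a measure \<Rightarrow> real \<Rightarrow> (int \<Rightarrow> 'a \<Rightarrow> real) \<Rightarrow> (int \<Rightarrow> 'a \<Rightarrow> real) \<Rightarrow> bool" where
  "out_of_reasonable_order M p X W \<longleftrightarrow> tends_to_infinity_in_prob M (order_index p X W)"

end

theory Submission
  imports Defs
begin

text \<open>
  Concomitants are linear in the underlying sequence, so by the triangle inequality the
  order indices of \<open>Y\<close> and \<open>\<epsilon>\<close> differ by at most that of \<open>Y0 = Y - \<epsilon>\<close>, which is \<open>O\<^sub>P(1)\<close>;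
  divergence in probability is insensitive to such a perturbation. Measurability of the order
  indices has to be checked, since a non-measurable event has the junk probability 0.
\<close>

text \<open>In a sorted list the entries that are at most \<open>c\<close> form an initial segment,
  so the filter has that segment's length. The inequality is strict because \<open>!\<close> counts
  from 0.\<close>

lemma sorted_nth_le_iff:
  fixes xs :: "'b::linorder list"
  assumes "sorted xs" "k < length xs"
  shows "xs ! k \<le> c \<longleftrightarrow> k < length (filter (\<lambda>x. x \<le> c) xs)"
  using assms
proof (induction xs arbitrary: k)
  case (Cons a xs)
  show ?case
  proof (cases "a \<le> c")
    case True
    with Cons show ?thesis by (cases k) auto
  next
    case False
    then have "\<not> x \<le> c" if "x \<in> set (a # xs)" for x
      using Cons.prems that by auto
    moreover from this have "filter (\<lambda>x. x \<le> c) (a # xs) = []"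
      by (meson filter_False)
    ultimately show ?thesis
      using Cons.prems by (metis list.size(3) not_less_zero nth_mem)
  qed
qed simp

lemma nth_sort_le_iff:
  fixes xs :: "'b::linorder list"
  assumes "k < length xs"
  shows "sort xs ! k \<le> c \<longleftrightarrow> k < length (filter (\<lambda>x. x \<le> c) xs)"
proof -
  have "length (filter (\<lambda>x. x \<le> c) (sort xs)) = length (filter (\<lambda>x. x \<le> c) xs)"
    by (metis mset_filter mset_sort size_mset)
  then show ?thesis
    using sorted_nth_le_iff[of "sort xs" k c] assms by simp
qed

text \<open>Sublevel sets are counting events: the entry at index \<open>k\<close> is at most
  \<open>c\<close> exactly when more than \<open>k\<close> of the variables are. Such a count is
  measurable by induction on the index list.\<close>

lemma borel_measurable_nth_sort:
  fixes X :: "'i \<Rightarrow> 'a \<Rightarrow> real"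
  assumes X: "\<And>i. X i \<in> borel_measurable M" and k: "k < length is"
  shows "(\<lambda>\<omega>. sort (map (\<lambda>i. X i \<omega>) is) ! k) \<in> borel_measurable M"
proof (rule borel_measurable_iff_le[THEN iffD2], rule allI)
  fix c
  have "(\<lambda>\<omega>. length (filter (\<lambda>x. x \<le> c) (map (\<lambda>i. X i \<omega>) js))) \<in> measurable M (count_space UNIV)" for js
  proof (induction js)
    case (Cons j js)
    note Cons [measurable] X [measurable]
    have "(\<lambda>\<omega>. if X j \<omega> \<le> c then Suc (length (filter (\<lambda>x. x \<le> c) (map (\<lambda>i. X i \<omega>) js)))
        else length (filter (\<lambda>x. x \<le> c) (map (\<lambda>i. X i \<omega>) js))) \<in> measurable M (count_space UNIV)"
      by measurable
    then show ?case by (simp add: if_distrib[of length] cong: if_cong)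
  qed simp
  note [measurable] = this
  have "{\<omega> \<in> space M. k < length (filter (\<lambda>x. x \<le> c) (map (\<lambda>i. X i \<omega>) is))} \<in> sets M"
    by measurable
  then show "{\<omega> \<in> space M. sort (map (\<lambda>i. X i \<omega>) is) ! k \<le> c} \<in> sets M"
    using k by (simp add: nth_sort_le_iff)
qed

text \<open>The bounds on \<open>t\<close> keep the index \<open>t - 1\<close> within the sorted
  list of length \<open>n\<close>; outside it \<open>!\<close> is unspecified.\<close>

lemma borel_measurable_concomitant:
  assumes X [measurable]: "\<And>s. X s \<in> borel_measurable M"
    and W [measurable]: "\<And>s. W s \<in> borel_measurable M"
    and t: "1 \<le> t" "t \<le> n"
  shows "concomitant X W n t \<in> borel_measurable M"
proof -
  have [measurable]: "(\<lambda>\<omega>. order_stat n (\<lambda>r. X r \<omega>) t) \<in> borel_measurable M"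
    unfolding order_stat_def by (rule borel_measurable_nth_sort) (use X t in auto)
  show ?thesis
    unfolding concomitant_def[abs_def] of_bool_def by measurable
qed

lemma borel_measurable_order_index:
  assumes "\<And>s. X s \<in> borel_measurable M" "\<And>s. W s \<in> borel_measurable M"
  shows "order_index p X W n \<in> borel_measurable M"
proof -
  \<comment> \<open>Summation starts at 2, so both \<open>t\<close> and \<open>t - 1\<close> lie
    between 1 and \<open>n\<close>.\<close>
  have "(\<lambda>\<omega>. \<Sum>t=2..n. \<bar>concomitant X W n t \<omega> - concomitant X W n (t - 1) \<omega>\<bar>) \<in> borel_measurable M"
    by (intro borel_measurable_sum borel_measurable_abs borel_measurable_diff
        borel_measurable_concomitant assms) auto
  then show ?thesis
    unfolding order_index_def[abs_def] by simp
qed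

text \<open>The indicator weights depend on \<open>X\<close> alone. The assumption concerns a single
  \<open>\<omega>\<close>, as the model equations hold only on \<open>space M\<close>.\<close>

lemma concomitant_diff:
  assumes "\<And>s. V s \<omega> = W s \<omega> - U s \<omega>"
  shows "concomitant X V n t \<omega> = concomitant X W n t \<omega> - concomitant X U n t \<omega>"
  by (simp add: concomitant_def assms left_diff_distrib sum_subtractf)

text \<open>Reverse triangle inequality for each increment, summed and scaled by the nonnegative
  factor \<open>real n powr (- 1 / p)\<close>. Being two-sided, the bound serves both directions of
  the equivalence.\<close>

lemma abs_order_index_diff_le:
  assumes "\<And>s. V s \<omega> = W s \<omega> - U s \<omega>"
  shows "\<bar>order_index p X W n \<omega> - order_index p X U n \<omega>\<bar> \<le> order_index p X V n \<omega>"
proof -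
  define d where "d W t = concomitant X W n t \<omega> - concomitant X W n (t - 1) \<omega>" for W t
  have d: "d V t = d W t - d U t" for t
    by (simp add: d_def concomitant_diff[where V = V and W = W and U = U] assms)
  have "\<bar>(\<Sum>t=2..n. \<bar>d W t\<bar>) - (\<Sum>t=2..n. \<bar>d U t\<bar>)\<bar> \<le> (\<Sum>t=2..n. \<bar>d V t\<bar>)"
    unfolding sum_subtractf[symmetric] d
    by (rule order_trans[OF sum_abs sum_mono]) (rule abs_triangle_ineq3)
  then show ?thesis
    by (simp add: order_index_def d_def right_diff_distrib[symmetric] abs_mult mult_left_mono)
qed

text \<open>If \<open>Z' n\<close> is at most \<open>K\<close>, then \<open>\<bar>B n\<bar>\<close>
  exceeds \<open>C\<close> or \<open>Z n\<close> is at most \<open>K + C\<close>. A suitable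
  \<open>C\<close> makes the first event rare, and divergence of \<open>Z\<close> then makes the
  second one rare.\<close>

lemma (in prob_space) tends_to_infinity_in_prob_perturb:
  assumes meas: "\<And>n. Z n \<in> borel_measurable M" "\<And>n. B n \<in> borel_measurable M"
    and le: "\<And>n \<omega>. \<omega> \<in> space M \<Longrightarrow> Z n \<omega> \<le> Z' n \<omega> + \<bar>B n \<omega>\<bar>"
    and B: "bounded_in_prob M B"
    and Z: "tends_to_infinity_in_prob M Z"
  shows "tends_to_infinity_in_prob M Z'"
  unfolding tends_to_infinity_in_prob_def
proof (intro allI LIMSEQ_I)
  fix K e :: real
  assume "0 < e"
  with B obtain C where C: "\<forall>\<^sub>F n in sequentially. prob {\<omega> \<in> space M. \<bar>B n \<omega>\<bar> > C} \<le> e / 2"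
    unfolding bounded_in_prob_def by (meson half_gt_zero)
  have "(\<lambda>n. prob {\<omega> \<in> space M. Z n \<omega> \<le> K + C}) \<longlonglongrightarrow> 0"
    using Z unfolding tends_to_infinity_in_prob_def by blast
  then have "\<forall>\<^sub>F n in sequentially. prob {\<omega> \<in> space M. Z n \<omega> \<le> K + C} < e / 2"
    by (rule order_tendstoD) (use \<open>0 < e\<close> in simp)
  with C have "\<forall>\<^sub>F n in sequentially. prob {\<omega> \<in> space M. Z' n \<omega> \<le> K} < e"
  proof eventually_elim
    case (elim n)
    note meas [measurable]
    \<comment> \<open>Monotonicity asks for measurability of the covering union, which comes from
      \<open>Z\<close> and \<open>B\<close>.\<close>
    have "prob {\<omega> \<in> space M. Z' n \<omega> \<le> K}
        \<le> prob ({\<omega> \<in> space M. Z n \<omega> \<le> K + C} \<union> {\<omega> \<in> space M. \<bar>B n \<omega>\<bar> > C})"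
    proof (rule finite_measure_mono)
      show "{\<omega> \<in> space M. Z' n \<omega> \<le> K}
          \<subseteq> {\<omega> \<in> space M. Z n \<omega> \<le> K + C} \<union> {\<omega> \<in> space M. \<bar>B n \<omega>\<bar> > C}"
      proof
        fix \<omega>
        assume "\<omega> \<in> {\<omega> \<in> space M. Z' n \<omega> \<le> K}"
        with le[of \<omega> n] show "\<omega> \<in> {\<omega> \<in> space M. Z n \<omega> \<le> K + C} \<union> {\<omega> \<in> space M. \<bar>B n \<omega>\<bar> > C}"
          by auto
      qed
    qed measurable
    also have "\<dots> \<le> prob {\<omega> \<in> space M. Z n \<omega> \<le> K + C} + prob {\<omega> \<in> space M. \<bar>B n \<omega>\<bar> > C}"
      by (rule measure_Un_le) measurable
    finally show ?case using elim by simp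
  qed
  then show "\<exists>N. \<forall>n\<ge>N. norm (prob {\<omega> \<in> space M. Z' n \<omega> \<le> K} - 0) < e"
    by (simp add: eventually_sequentially)
qed

theorem theorem8p2:
  fixes M :: "'a measure"
    and X \<epsilon> Y Y0 :: "int \<Rightarrow> 'a \<Rightarrow> real"
    and h0 F :: "real \<Rightarrow> real"
    and p :: real
  assumes "prob_space M"
    and "\<And>t. X t \<in> borel_measurable M"
    and "stationary M X"
    and "\<And>t. cdf (distr M borel (X t)) = F"
    and "continuous_on UNIV F"
    and "AE \<omega> in M. \<forall>s t. s \<noteq> t \<longrightarrow> X s \<omega> \<noteq> X t \<omega>"
    and "\<And>t. \<epsilon> t \<in> borel_measurable M"
    and "\<And>t. Y0 t \<in> borel_measurable M"
    and "\<And>t \<omega>. \<omega> \<in> space M \<Longrightarrow> Y0 t \<omega> = h0 (X t \<omega>)"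
    and "\<And>t \<omega>. \<omega> \<in> space M \<Longrightarrow> Y t \<omega> = h0 (X t \<omega>) + \<epsilon> t \<omega>"
    and "p > 0"
    and "in_reasonable_order M p X Y0"
  shows "out_of_reasonable_order M p X Y \<longleftrightarrow> out_of_reasonable_order M p X \<epsilon>"
proof -
  interpret prob_space M by fact
  note meas = borel_measurable_order_index[OF assms(2)]
  \<comment> \<open>As \<open>h0\<close> is arbitrary, measurability of \<open>Y\<close> is drawn
    from that of \<open>Y0\<close> and \<open>\<epsilon>\<close>, whose sum agrees with
    \<open>Y\<close> on \<open>space M\<close>.\<close>
  have "Y t \<in> borel_measurable M" for t
  proof -
    have "Y t \<in> borel_measurable M \<longleftrightarrow> (\<lambda>\<omega>. Y0 t \<omega> + \<epsilon> t \<omega>) \<in> borel_measurable M"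
      by (rule measurable_cong) (simp add: assms(9,10))
    then show ?thesis using assms(7,8) by simp
  qed
  note meas' = meas[OF this] meas[OF assms(7)] meas[OF assms(8)]
  have diff: "\<bar>order_index p X Y n \<omega> - order_index p X \<epsilon> n \<omega>\<bar> \<le> order_index p X Y0 n \<omega>"
    if "\<omega> \<in> space M" for n \<omega>
    by (rule abs_order_index_diff_le) (simp add: that assms(9,10))
  have B: "bounded_in_prob M (order_index p X Y0)"
    using assms(12) unfolding in_reasonable_order_def .
  show ?thesis
    unfolding out_of_reasonable_order_def
  proof
    assume "tends_to_infinity_in_prob M (order_index p X Y)"
    then show "tends_to_infinity_in_prob M (order_index p X \<epsilon>)"
    \<comment> \<open>\<open>Y\<close> diverges, \<open>Y0\<close> is the perturbation;
      \<open>rotated\<close> lets the chained divergence discharge its premise first, leaving the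
      pointwise bound.\<close>
    proof (rule tends_to_infinity_in_prob_perturb[OF meas'(1,3) _ B, rotated])
      fix n \<omega>
      assume "\<omega> \<in> space M"
      from diff[OF this, of n]
      show "order_index p X Y n \<omega> \<le> order_index p X \<epsilon> n \<omega> + \<bar>order_index p X Y0 n \<omega>\<bar>"
        by linarith
    qed
  next
    assume "tends_to_infinity_in_prob M (order_index p X \<epsilon>)"
    then show "tends_to_infinity_in_prob M (order_index p X Y)"
    \<comment> \<open>The same argument with \<open>Y\<close> and \<open>\<epsilon>\<close>
      exchanged.\<close>
    proof (rule tends_to_infinity_in_prob_perturb[OF meas'(2,3) _ B, rotated])
      fix n \<omega>
      assume "\<omega> \<in> space M"
      from diff[OF this, of n]
      show "order_index p X \<epsilon> n \<omega> \<le> order_index p X Y n \<omega> + \<bar>order_index p X Y0 n \<omega>\<bar>"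
        by linarith
    qed
  qed
qed

end
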